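(* Let $s\le t$ be fixed positive integers with $st$ even. Then, as $n\to\infty$, \[ r_{odd}(n,K_{s,t}) \ge (1+o(1))\left(\frac{n}{t}\right)^{1/\lceil s/2\rceil}, \] where $o(1)$ denotes a quantity tending to $0$ as $n\to\infty$ with $s,t$ fixed.
   Context: $K_n$ is the complete graph on vertex set $[n]=\{1,\ldots,n\}$, and $K_{s,t}$ is the complete bipartite graph with parts of sizes $s$ and $t$. A copy of a graph $H$ in $K_n$ is a (not necessarily induced) subgraph of $K_n$ isomorphic to $H$. For a positive integer $r$, an $r$-colouring $G_1,\ldots,G_r$ of $K_n$ is a partition of the edge set of $K_n$ into $r$ (possibly empty) colour classes. A copy of $H$ has an odd colour class if it contains an odd number of edges of $G_i$ for some $i$. The odd-Ramsey number $r_{odd}(n,H)$ of a graph $H$ is the minimum positive integer $r$ for which there exists an $r$-colouring of $K_n$ such that every copy of $H$ in $K_n$ has an odd colour class. *)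

theory Defs
  imports Complex_Main "HOL-Library.Disjoint_Sets"
begin

record 'a sgraph =
  verts :: "'a set"
  edges :: "'a set set"

definition simple_graph :: "'a sgraph \<Rightarrow> bool" where
  "simple_graph G \<longleftrightarrow> (\<forall>e\<in>edges G. e \<subseteq> verts G \<and> card e = 2)"

definition subgraph :: "'a sgraph \<Rightarrow> 'a sgraph \<Rightarrow> bool" where
  "subgraph F G \<longleftrightarrow> simple_graph F \<and> simple_graph G \<and> verts F \<subseteq> verts G \<and> edges F \<subseteq> edges G"

definition isomorphic :: "'a sgraph \<Rightarrow> 'b sgraph \<Rightarrow> bool" where
  "isomorphic G H \<longleftrightarrow>
     (\<exists>f. bij_betw f (verts G) (verts H) \<and>
          (\<forall>u\<in>verts G. \<forall>v\<in>verts G. {u, v} \<in> edges G \<longleftrightarrow> {f u, f v} \<in> edges H))"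

definition is_copy :: "'b sgraph \<Rightarrow> 'a sgraph \<Rightarrow> 'a sgraph \<Rightarrow> bool" where
  "is_copy H G F \<longleftrightarrow> subgraph F G \<and> isomorphic H F"

definition complete_graph :: "nat \<Rightarrow> nat sgraph" where
  "complete_graph n = \<lparr>verts = {1..n}, edges = {e. e \<subseteq> {1..n} \<and> card e = 2}\<rparr>"

definition complete_bipartite :: "nat \<Rightarrow> nat \<Rightarrow> (nat + nat) sgraph" where
  "complete_bipartite s t =
     \<lparr>verts = {1..s} <+> {1..t}, edges = {{Inl i, Inr j} |i j. i \<in> {1..s} \<and> j \<in> {1..t}}\<rparr>"

text \<open>The classes \<open>C 1, \<dots>, C r\<close> may be empty; \<open>C\<close> is irrelevant outside \<open>{1..r}\<close>.\<close>

definition edge_colouring :: "'a sgraph \<Rightarrow> nat \<Rightarrow> (nat \<Rightarrow> 'a set set) \<Rightarrow> bool" where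
  "edge_colouring G r C \<longleftrightarrow> disjoint_family_on C {1..r} \<and> (\<Union>i\<in>{1..r}. C i) = edges G"

definition has_odd_class :: "nat \<Rightarrow> (nat \<Rightarrow> 'a set set) \<Rightarrow> 'a sgraph \<Rightarrow> bool" where
  "has_odd_class r C F \<longleftrightarrow> (\<exists>i\<in>{1..r}. odd (card (edges F \<inter> C i)))"

text \<open>The minimum is over a nonempty set whenever \<open>H\<close> has an edge: give every edge of the
  complete graph its own colour. (For edgeless \<open>H\<close> no colouring need exist, and then the
  value of \<open>LEAST\<close> is unspecified.)\<close>

definition r_odd :: "nat \<Rightarrow> 'b sgraph \<Rightarrow> nat" where
  "r_odd n H = (LEAST r. r > 0 \<and>
     (\<exists>C. edge_colouring (complete_graph n) r C \<and>
          (\<forall>F. is_copy H (complete_graph n) F \<longrightarrow> has_odd_class r C F)))"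

end

(* Fix a colouring with r colours and build an even copy greedily. For a set W of vertices and a
   set A of candidates, averaging over pairs gives a, b in A such that about |W|/r vertices of W
   see a and b in the same colour. Iterating k times produces a set S of 2k vertices and about
   n/r^k vertices each of which sends an even number of edges of every colour to S. If s = 2k,
   any t of them give an even copy. If s = 2k + 1, then t is even: add one further vertex a to S
   and, by the pigeonhole principle, choose the t vertices as t/2 pairs with equal colours to a;
   this is possible as soon as there are t + r of them, and t + r - 1 \<le> t r. In both cases an
   odd colouring forces n (1 - o(1)) \<le> t r^K with K = \<lceil>s/2\<rceil>. *)

theory Submission
  imports Defs "HOL-Analysis.Convex" "HOL-Real_Asymp.Real_Asymp"
begin

section \<open>Popular pairs by averaging\<close>

text \<open>Cauchy-Schwarz over the fibres of \<open>f\<close>: the collisions, counted as ordered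
  pairs with the diagonal, number the sum of the squared fibre sizes.\<close>

lemma card_sq_le_collisions:
  fixes f :: "'a \<Rightarrow> 'b"
  assumes "finite B" "finite K" "f ` B \<subseteq> K"
  shows "(real (card B))\<^sup>2 \<le> real (card K) * real (card {p\<in>B\<times>B. f (fst p) = f (snd p)})"
proof -
  define d where "d i = card {a\<in>B. f a = i}" for i
  have cB: "card B = (\<Sum>i\<in>K. d i)"
    using sum.group[OF assms, of "\<lambda>_. 1::nat"] by (simp add: d_def)
  have "{p\<in>B\<times>B. f (fst p) = f (snd p)} = (\<Union>i\<in>K. {a\<in>B. f a = i} \<times> {a\<in>B. f a = i})"
    using assms(3) by auto
  also have "card \<dots> = (\<Sum>i\<in>K. card ({a\<in>B. f a = i} \<times> {a\<in>B. f a = i}))"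
    by (rule card_UN_disjoint) (use assms in auto)
  finally have "card {p\<in>B\<times>B. f (fst p) = f (snd p)} = (\<Sum>i\<in>K. (d i)\<^sup>2)"
    by (simp add: d_def power2_eq_square card_cartesian_product)
  moreover have "(\<Sum>i\<in>K. real (d i))\<^sup>2 \<le> (\<Sum>i\<in>K. (real (d i))\<^sup>2) * real (card K)"
    by (rule sum_squared_le_sum_of_squares)
  ultimately show ?thesis
    using cB by (simp add: mult.commute)
qed

text \<open>Double counting of \<open>v\<close> against ordered pairs of distinct candidates: each
  \<open>v\<close> sees many pairs in one colour by Cauchy-Schwarz, so some pair is seen thus by at
  least the average number of \<open>v\<close>. \<open>W\<close> and \<open>A\<close> may overlap,
  and \<open>c v v\<close> carries no meaning, so \<open>v\<close> itself is kept out of its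
  pairs.\<close>

lemma popular_monochromatic_pair:
  fixes c :: "'a \<Rightarrow> 'a \<Rightarrow> 'b"
  assumes fin: "finite A" "finite W" "finite K" and A2: "card A \<ge> 2"
    and col: "\<forall>v\<in>W. c v ` (A - {v}) \<subseteq> K"
  obtains a b where "a \<in> A" "b \<in> A" "a \<noteq> b"
    "real (card W) * (real (card A) - 1 - real (card K))
      \<le> real (card {v\<in>W. a \<noteq> v \<and> b \<noteq> v \<and> c v a = c v b}) * real (card K) * real (card A)"
proof (cases "real (card A) - 1 \<le> real (card K)")
  case True
  obtain X where "X \<subseteq> A" "card X = 2" using A2 by (rule obtain_subset_with_card_n)
  then obtain a b where "a \<in> A" "b \<in> A" "a \<noteq> b" by (auto simp: card_2_iff)
  \<comment> \<open>With so few candidates the bound is vacuous and any pair will do.\<close>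
  have "real (card W) * (real (card A) - 1 - real (card K)) \<le> 0"
    using True by (simp add: mult_nonneg_nonpos)
  also have "0 \<le> real (card {v\<in>W. a \<noteq> v \<and> b \<noteq> v \<and> c v a = c v b}) * real (card K) * real (card A)"
    by simp
  finally show ?thesis
    using \<open>a \<in> A\<close> \<open>b \<in> A\<close> \<open>a \<noteq> b\<close> by (intro that[of a b])
next
  case False
  define n r where "n = real (card A)" and "r = real (card K)"
  define D where "D = {p\<in>A\<times>A. fst p \<noteq> snd p}"
  define good where "good v p \<longleftrightarrow> fst p \<noteq> v \<and> snd p \<noteq> v \<and> c v (fst p) = c v (snd p)" for v p
  have "finite D" by (simp add: D_def fin)
  have "D = (SIGMA a:A. A - {a})" by (auto simp: D_def)
  then have "card D = (\<Sum>a\<in>A. card A - 1)" using fin by (simp add: card_SigmaI)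
  then have cD: "real (card D) = n * (n - 1)" using A2 by (simp add: n_def of_nat_diff)
  have lower: "(n - 1) * (n - 1 - r) \<le> r * real (card {p\<in>D. good v p})" if "v \<in> W" for v
  proof -
    define B where "B = A - {v}"
    define m where "m = real (card B)"
    have finB: "finite B" by (simp add: B_def fin)
    have m: "n - 1 \<le> m"
      using fin A2 card_Diff1_le[of A "v"] by (auto simp: m_def n_def B_def card_Diff_singleton_if)
    \<comment> \<open>Removing the \<open>m\<close> diagonal collisions turns the Cauchy-Schwarz
      bound into \<open>m * (m - r)\<close> for the good pairs.\<close>
    have "{p\<in>B\<times>B. c v (fst p) = c v (snd p)} = {p\<in>D. good v p} \<union> (\<lambda>a. (a, a)) ` B"
      by (auto simp: B_def D_def good_def)
    moreover have "card ({p\<in>D. good v p} \<union> (\<lambda>a. (a, a)) ` B) = card {p\<in>D. good v p} + card B"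
      by (subst card_Un_disjoint)
         (use finB \<open>finite D\<close> in \<open>auto simp: D_def card_image inj_on_def fin\<close>)
    moreover have "c v ` B \<subseteq> K" using col that by (simp add: B_def)
    ultimately have "m\<^sup>2 \<le> r * (real (card {p\<in>D. good v p}) + m)"
      using card_sq_le_collisions[OF finB fin(3), of "c v"] by (simp add: m_def r_def)
    then have "m * (m - r) \<le> r * real (card {p\<in>D. good v p})"
      by (simp add: algebra_simps power2_eq_square)
    moreover have "(n - 1) * (n - 1 - r) \<le> m * (m - r)"
      using m False A2 by (intro mult_mono) (auto simp: n_def r_def)
    ultimately show ?thesis by linarith
  qed
  have swap: "(\<Sum>v\<in>W. card {p\<in>D. good v p}) = (\<Sum>p\<in>D. card {v\<in>W. good v p})"
    by (rule sum_multicount_gen) (use fin \<open>finite D\<close> in auto)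
  have "\<exists>p\<in>D. real (card W) * (n - 1 - r) \<le> real (card {v\<in>W. good v p}) * r * n"
  proof (rule ccontr)
    assume "\<not> ?thesis"
    then have less: "\<And>p. p \<in> D \<Longrightarrow> real (card {v\<in>W. good v p}) * r * n < real (card W) * (n - 1 - r)"
      by force
    have "0 < n * (n - 1)" using A2 by (simp add: n_def)
    with cD have "D \<noteq> {}" by force
    then have "(\<Sum>p\<in>D. real (card {v\<in>W. good v p}) * r * n) < (\<Sum>p\<in>D. real (card W) * (n - 1 - r))"
      by (intro sum_strict_mono less \<open>finite D\<close>)
    also have "\<dots> = n * (\<Sum>v\<in>W. (n - 1) * (n - 1 - r))" by (simp add: cD)
    also have "\<dots> \<le> n * (\<Sum>v\<in>W. r * real (card {p\<in>D. good v p}))"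
      by (intro mult_left_mono sum_mono lower) (auto simp: n_def)
    also have "\<dots> = n * r * real (\<Sum>v\<in>W. card {p\<in>D. good v p})"
      by (simp add: sum_distrib_left mult.assoc)
    also have "\<dots> = (\<Sum>p\<in>D. real (card {v\<in>W. good v p}) * r * n)"
      unfolding swap by (simp add: sum_distrib_left mult_ac)
    finally show False by simp
  qed
  then obtain a b where "(a, b) \<in> D"
    "real (card W) * (n - 1 - r) \<le> real (card {v\<in>W. good v (a, b)}) * r * n" by auto
  then show ?thesis
    by (intro that[of a b]) (auto simp: D_def good_def n_def r_def)
qed

section \<open>Growing sets with even colour classes\<close>

text \<open>The parity invariant of both greedy constructions: it serves to grow the part
  \<open>S\<close> seen from a fixed vertex, and to collect the other part in pairs.\<close>

lemma even_colour_classes_insert2: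
  assumes "finite S" "a \<notin> S" "b \<notin> S" "a \<noteq> b" "f a = f b"
    and "\<And>i. even (card {u\<in>S. f u = i})"
  shows "even (card {u\<in>insert a (insert b S). f u = i})"
proof (cases "f a = i")
  case True
  then have "{u\<in>insert a (insert b S). f u = i} = insert a (insert b {u\<in>S. f u = i})"
    using assms(5) by auto
  then show ?thesis using assms by simp
next
  case False
  then have "{u\<in>insert a (insert b S). f u = i} = {u\<in>S. f u = i}"
    using assms(5) by auto
  then show ?thesis using assms(6) by simp
qed

text \<open>Each round adds a popular pair from \<open>V - S\<close> to \<open>S\<close>. With
  \<open>m\<close> candidates left, a round keeps at least a fraction
  \<open>(m - 1 - r) / (m * r)\<close> of \<open>W\<close>. The factor
  \<open>(m - 1 - r) / m\<close> increases with \<open>m\<close>, so the condition on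
  \<open>x\<close>, which concerns the last of \<open>k\<close> rounds, makes \<open>x\<close> a
  lower bound for it in every round.\<close>

lemma even_part_large_neighbourhood:
  fixes c :: "'a \<Rightarrow> 'a \<Rightarrow> 'b"
  assumes fin: "finite V" "finite K"
    and col: "\<forall>v\<in>V. c v ` (V - {v}) \<subseteq> K"
    and x: "0 \<le> x" "x * (real (card V) - 2 * real k + 2) \<le> real (card V) - 2 * real k + 1 - real (card K)"
    and "2 * k \<le> card V" "j \<le> k"
  shows "\<exists>S W. S \<subseteq> V \<and> W \<subseteq> V - S \<and> card S = 2 * j \<and>
    (\<forall>v\<in>W. \<forall>i. even (card {u\<in>S. c v u = i})) \<and>
    real (card V) * x ^ j \<le> real (card W) * real (card K) ^ j"
  using \<open>j \<le> k\<close>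
proof (induction j)
  case 0
  then show ?case by (intro exI[of _ "{}"] exI[of _ V]) auto
next
  case (Suc j)
  then obtain S W where SW: "S \<subseteq> V" "W \<subseteq> V - S" "card S = 2 * j"
    "\<And>v i. v \<in> W \<Longrightarrow> even (card {u\<in>S. c v u = i})"
    "real (card V) * x ^ j \<le> real (card W) * real (card K) ^ j" by auto
  have finS: "finite S" "finite W" using SW fin by (auto intro: finite_subset)
  define n r m where "n = real (card V)" and "r = real (card K)" and "m = n - 2 * real j"
  have cA: "card (V - S) = card V - 2 * j" using SW finS by (simp add: card_Diff_subset)
  have m: "real (card (V - S)) = m"
    using Suc.prems assms(6) by (simp add: cA m_def n_def of_nat_diff)
  have "card (V - S) \<ge> 2" using Suc.prems assms(6) by (simp add: cA)
  moreover have "\<forall>v\<in>W. c v ` (V - S - {v}) \<subseteq> K"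
    using col SW(2) by blast
  ultimately obtain a b where ab: "a \<in> V - S" "b \<in> V - S" "a \<noteq> b"
    "real (card W) * (m - 1 - r) \<le> real (card {v\<in>W. a \<noteq> v \<and> b \<noteq> v \<and> c v a = c v b}) * r * m"
    using popular_monochromatic_pair[of "V - S" W K c] fin finS
    unfolding m r_def by blast
  \<comment> \<open>Dropping \<open>a\<close> and \<open>b\<close> themselves keeps the new
    \<open>W\<close> disjoint from the new \<open>S\<close>.\<close>
  define W' where "W' = {v\<in>W. a \<noteq> v \<and> b \<noteq> v \<and> c v a = c v b}"
  have m2: "m \<ge> n - 2 * real k + 2" and m0: "m > 0"
    using Suc.prems assms(6) by (auto simp: m_def n_def)
  have x1: "x \<le> 1"
  proof (rule ccontr)
    assume "\<not> x \<le> 1"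
    then have "1 * (n - 2 * real k + 2) \<le> x * (n - 2 * real k + 2)"
      using assms(6) by (intro mult_right_mono) (auto simp: n_def)
    then show False using x by (simp add: n_def)
  qed
  \<comment> \<open>The condition on \<open>x\<close> says that \<open>r + 1\<close> is at most the
    left-hand side; as \<open>x\<close> is at most 1, it passes to the larger
    \<open>m\<close>.\<close>
  have "(1 - x) * (n - 2 * real k + 2) \<le> (1 - x) * m"
    using m2 x1 by (intro mult_left_mono) auto
  then have xm: "x * m \<le> m - 1 - r"
    using x(2) by (simp add: n_def r_def algebra_simps)
  have "real (card W) * (x * m) \<le> real (card W') * r * m"
    using ab(4) xm mult_left_mono[OF xm, of "real (card W)"] by (simp add: W'_def)
  then have step: "real (card W) * x \<le> real (card W') * r" using m0 by simp
  have "n * x ^ Suc j = (n * x ^ j) * x" by simp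
  also have "\<dots> \<le> (real (card W) * r ^ j) * x"
    using SW(5) x(1) by (intro mult_right_mono) (auto simp: n_def r_def)
  also have "\<dots> = (real (card W) * x) * r ^ j" by simp
  also have "\<dots> \<le> (real (card W') * r) * r ^ j"
    by (intro mult_right_mono step) (simp add: r_def)
  finally have "n * x ^ Suc j \<le> real (card W') * r ^ Suc j" by (simp add: mult_ac)
  moreover have "even (card {u\<in>insert a (insert b S). c v u = i})" if "v \<in> W'" for v i
    using that ab SW(4) finS by (intro even_colour_classes_insert2) (auto simp: W'_def)
  ultimately show ?case
    using SW ab finS
    by (intro exI[of _ "insert a (insert b S)"] exI[of _ W']) (auto simp: W'_def n_def r_def)
qed

text \<open>Pigeonhole, one equally coloured pair at a time. Before the last pair is chosen,
  \<open>card U - 2 * m + 2\<close> elements remain, which by hypothesis exceeds the number of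
  colours.\<close>

lemma even_subset_exists:
  fixes f :: "'a \<Rightarrow> 'b"
  assumes "finite U" "finite K" "f ` U \<subseteq> K" "2 * m + card K \<le> card U + 1"
  shows "\<exists>T\<subseteq>U. card T = 2 * m \<and> (\<forall>i. even (card {u\<in>T. f u = i}))"
  using assms(4)
proof (induction m)
  case 0
  then show ?case by (intro exI[of _ "{}"]) auto
next
  case (Suc m)
  then obtain T where T: "T \<subseteq> U" "card T = 2 * m" "\<And>i. even (card {u\<in>T. f u = i})" by auto
  have "finite T" using T assms(1) finite_subset by blast
  have "card (f ` (U - T)) \<le> card K" using assms by (intro card_mono) auto
  also have "\<dots> < card (U - T)" using T \<open>finite T\<close> Suc.prems by (simp add: card_Diff_subset)
  finally obtain a b where "a \<in> U - T" "b \<in> U - T" "a \<noteq> b" "f a = f b"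
    using pigeonhole unfolding inj_on_def by blast
  then show ?case
    using T \<open>finite T\<close> even_colour_classes_insert2[of T a b f]
    by (intro exI[of _ "insert a (insert b T)"]) auto
qed

section \<open>Colourings without an even pair\<close>

text \<open>The complete bipartite graph between \<open>S\<close> and \<open>T\<close> has no odd colour class, its edges being
  counted from \<open>T\<close>, with \<open>c v u\<close> the colour of \<open>{u, v}\<close>.\<close>

definition even_pair :: "('a \<Rightarrow> 'a \<Rightarrow> 'b) \<Rightarrow> 'a set \<Rightarrow> 'a set \<Rightarrow> bool" where
  "even_pair c S T \<longleftrightarrow> (\<forall>i. even (\<Sum>v\<in>T. card {u\<in>S. c v u = i}))"

text \<open>Any \<open>t\<close> vertices of \<open>W\<close> would form an even pair with
  \<open>S\<close>, so \<open>W\<close> has at most \<open>t - 1\<close>. Keeping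
  \<open>t - 1\<close> rather than \<open>t\<close> matters in
  \<open>r_odd_linear_bound\<close>.\<close>

lemma many_colours_if_no_even_pair:
  fixes c :: "'a \<Rightarrow> 'a \<Rightarrow> 'b"
  assumes fin: "finite V" "finite K"
    and col: "\<forall>v\<in>V. c v ` (V - {v}) \<subseteq> K"
    and x: "0 \<le> x" "x * (real (card V) - 2 * real k + 2) \<le> real (card V) - 2 * real k + 1 - real (card K)"
    and "2 * k \<le> card V"
    and none: "\<And>S T. S \<subseteq> V \<Longrightarrow> T \<subseteq> V - S \<Longrightarrow> card S = 2 * k \<Longrightarrow> card T = t \<Longrightarrow> \<not> even_pair c S T"
  shows "real (card V) * x ^ k \<le> (real t - 1) * real (card K) ^ k"
proof -
  obtain S W where SW: "S \<subseteq> V" "W \<subseteq> V - S" "card S = 2 * k"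
    "\<And>v i. v \<in> W \<Longrightarrow> even (card {u\<in>S. c v u = i})"
    "real (card V) * x ^ k \<le> real (card W) * real (card K) ^ k"
    using even_part_large_neighbourhood[OF fin col x assms(6) order_refl] by blast
  have "card W < t"
  proof (rule ccontr)
    assume "\<not> card W < t"
    then obtain T where "T \<subseteq> W" "card T = t" by (meson not_less obtain_subset_with_card_n)
    moreover have "even_pair c S T"
      using SW(4) \<open>T \<subseteq> W\<close> unfolding even_pair_def by (auto intro!: dvd_sum)
    ultimately show False using none[of S T] SW by auto
  qed
  then have "real (card W) * real (card K) ^ k \<le> (real t - 1) * real (card K) ^ k"
    by (intro mult_right_mono) auto
  with SW(5) show ?thesis by linarith
qed

text \<open>Here \<open>W\<close> has at most \<open>t + r - 1\<close> vertices, with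
  \<open>r\<close> the number of colours. Bounding this by \<open>t * r\<close> costs one more
  factor \<open>r\<close>, which is why the exponent rises to \<open>k + 1\<close>.\<close>

lemma many_colours_if_no_even_pair_odd:
  fixes c :: "'a \<Rightarrow> 'a \<Rightarrow> 'b"
  assumes fin: "finite V" "finite K" and "K \<noteq> {}"
    and col: "\<forall>v\<in>V. c v ` (V - {v}) \<subseteq> K"
    and x: "0 \<le> x" "x * (real (card V) - 2 * real k + 2) \<le> real (card V) - 2 * real k + 1 - real (card K)"
    and "2 * k < card V" "even t" "t > 0"
    and none: "\<And>S T. S \<subseteq> V \<Longrightarrow> T \<subseteq> V - S \<Longrightarrow> card S = 2 * k + 1 \<Longrightarrow> card T = t \<Longrightarrow> \<not> even_pair c S T"
  shows "real (card V) * x ^ k \<le> real t * real (card K) ^ (k + 1)"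
proof -
  have "2 * k \<le> card V" using assms(7) by simp
  then obtain S W where SW: "S \<subseteq> V" "W \<subseteq> V - S" "card S = 2 * k"
    "\<And>v i. v \<in> W \<Longrightarrow> even (card {u\<in>S. c v u = i})"
    "real (card V) * x ^ k \<le> real (card W) * real (card K) ^ k"
    using even_part_large_neighbourhood[OF fin col x _ order_refl] by blast
  have finS: "finite S" "finite W" using SW fin by (auto intro: finite_subset)
  have "card (V - S) > 0" using SW finS assms(7) by (simp add: card_Diff_subset)
  then obtain a where a: "a \<in> V - S" by (metis card_gt_0_iff ex_in_conv)
  have K0: "card K \<ge> 1" using assms(2,3) by (simp add: Suc_leI card_gt_0_iff)
  have "card W + 1 \<le> t + card K"
  proof (rule ccontr)
    assume *: "\<not> card W + 1 \<le> t + card K"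
    obtain m where m: "t = 2 * m" using \<open>even t\<close> by blast
    \<comment> \<open>The vertex \<open>a\<close> may lie in \<open>W\<close>; the
      \<open>+ 1\<close> allowed by \<open>even_subset_exists\<close> pays for its removal.\<close>
    have large: "2 * m + card K \<le> card (W - {a}) + 1"
      using * m finS by (auto simp: card_Diff_singleton_if)
    have sub: "(\<lambda>v. c v a) ` (W - {a}) \<subseteq> K"
    proof (rule image_subsetI)
      fix v assume "v \<in> W - {a}"
      then have "v \<in> V" "a \<in> V - {v}" using SW(2) a by auto
      then show "c v a \<in> K" using col by blast
    qed
    obtain T where T: "T \<subseteq> W - {a}" "card T = t" "\<And>i. even (card {v\<in>T. c v a = i})"
      using even_subset_exists[OF finite_Diff[OF finS(2)] fin(2) sub large] unfolding m by blast
    have finT: "finite T" using T finS finite_subset by blast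
    have "even_pair c (insert a S) T"
      unfolding even_pair_def
    proof
      fix i
      have "card {u\<in>insert a S. c v u = i} = card {u\<in>S. c v u = i} + (if c v a = i then 1 else 0)" for v
      proof -
        have "{u\<in>insert a S. c v u = i} = (if c v a = i then insert a {u\<in>S. c v u = i} else {u\<in>S. c v u = i})"
          by auto
        then show ?thesis using a finS by simp
      qed
      \<comment> \<open>The vertex \<open>a\<close> contributes exactly its edges of colour
        \<open>i\<close> to \<open>T\<close>, an even number by the choice of
        \<open>T\<close>.\<close>
      then have "(\<Sum>v\<in>T. card {u\<in>insert a S. c v u = i})
          = (\<Sum>v\<in>T. card {u\<in>S. c v u = i}) + card {v\<in>T. c v a = i}"
        using finT by (simp add: sum.distrib sum.If_cases Int_def)
      moreover have "even (\<Sum>v\<in>T. card {u\<in>S. c v u = i})"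
        using SW(4) T(1) by (auto intro!: dvd_sum)
      ultimately show "even (\<Sum>v\<in>T. card {u\<in>insert a S. c v u = i})"
        using T(3)[of i] by simp
    qed
    moreover have "T \<subseteq> V - insert a S" "insert a S \<subseteq> V" using SW(1,2) T(1) a by blast+
    ultimately show False using none[of "insert a S" T] SW(3) T(2) a finS by simp
  qed
  then have "real (card W) \<le> real t + real (card K) - 1" by linarith
  also have "\<dots> \<le> real t * real (card K)"
    using mult_nonneg_nonneg[of "real t - 1" "real (card K) - 1"] K0 assms(9)
    by (simp add: algebra_simps)
  finally have "real (card W) * real (card K) ^ k \<le> real t * real (card K) * real (card K) ^ k"
    by (intro mult_right_mono) auto
  with SW(5) show ?thesis by (simp add: mult_ac)
qed

section \<open>Copies of complete bipartite graphs and odd colourings\<close>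

lemma simple_complete_graph: "simple_graph (complete_graph n)"
  by (auto simp: simple_graph_def complete_graph_def)

lemma bipartite_is_copy:
  assumes S: "S \<subseteq> {1..n}" and T: "T \<subseteq> {1..n} - S" and "card S = s" "card T = t"
  shows "is_copy (complete_bipartite s t) (complete_graph n)
    \<lparr>verts = S \<union> T, edges = {{u, v} |u v. u \<in> S \<and> v \<in> T}\<rparr>" (is "is_copy _ _ ?F")
proof -
  have fin: "finite S" "finite T" using assms by (auto intro: finite_subset)
  have dis: "S \<inter> T = {}" using T by auto
  obtain f where f: "bij_betw f {1..s} S"
    using finite_same_card_bij[of "{1..s}" S] fin assms(3) by auto
  obtain g where g: "bij_betw g {1..t} T"
    using finite_same_card_bij[of "{1..t}" T] fin assms(4) by auto
  have "bij_betw (case_sum f g) ({1..s} <+> {1..t}) (S \<union> T)"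
    unfolding Plus_def
  proof (rule bij_betw_combine[OF _ _ dis])
    show "bij_betw (case_sum f g) (Inl ` {1..s}) S"
      using f by (simp add: bij_betw_def image_image inj_on_imageI case_sum_o_inj)
    show "bij_betw (case_sum f g) (Inr ` {1..t}) T"
      using g by (simp add: bij_betw_def image_image inj_on_imageI case_sum_o_inj)
  qed
  moreover have "{u, v} \<in> edges (complete_bipartite s t)
      \<longleftrightarrow> {case_sum f g u, case_sum f g v} \<in> edges ?F"
    if "u \<in> {1..s} <+> {1..t}" "v \<in> {1..s} <+> {1..t}" for u v
  proof -
    \<comment> \<open>The non-memberships are what rule out edges inside one part.\<close>
    have "f i \<in> S" "f i \<notin> T" if "i \<in> {1..s}" for i using bij_betwE[OF f] that dis by blast+
    moreover have "g j \<in> T" "g j \<notin> S" if "j \<in> {1..t}" for j using bij_betwE[OF g] that dis by blast+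
    ultimately show ?thesis
      using that by (cases u; cases v; simp add: complete_bipartite_def doubleton_eq_iff Plus_def image_iff) metis+
  qed
  ultimately have "isomorphic (complete_bipartite s t) ?F"
    unfolding isomorphic_def complete_bipartite_def by (intro exI[of _ "case_sum f g"]) simp
  moreover have "subgraph ?F (complete_graph n)"
  proof -
    have "{u, v} \<subseteq> {1..n} \<and> card {u, v} = 2" if "u \<in> S" "v \<in> T" for u v
    proof -
      have "u \<noteq> v" using that T by blast
      then show ?thesis using that S T by auto
    qed
    then have "\<forall>e\<in>edges ?F. e \<subseteq> S \<union> T \<and> e \<subseteq> {1..n} \<and> card e = 2" by auto
    then show ?thesis
      using S T simple_complete_graph by (auto simp: subgraph_def simple_graph_def complete_graph_def)
  qed
  ultimately show ?thesis by (simp add: is_copy_def)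
qed

text \<open>Passes from colour classes to a colour function, the language of the counting lemmas.
  Off the diagonal the class of an edge exists because the classes cover and is unique because they
  are disjoint.\<close>

lemma no_even_pair_in_odd_colouring:
  assumes C: "edge_colouring (complete_graph n) r C"
    and odd: "\<And>F. is_copy (complete_bipartite s t) (complete_graph n) F \<Longrightarrow> has_odd_class r C F"
  obtains c where "\<forall>v\<in>{1..n}. c v ` ({1..n} - {v}) \<subseteq> {1..r}"
    "\<And>S T. S \<subseteq> {1..n} \<Longrightarrow> T \<subseteq> {1..n} - S \<Longrightarrow> card S = s \<Longrightarrow> card T = t \<Longrightarrow> \<not> even_pair c S T"
proof -
  define c where "c v u = (SOME i. i \<in> {1..r} \<and> {u, v} \<in> C i)" for v u
  have c: "c v u \<in> {1..r}" "{u, v} \<in> C (c v u)" if "v \<in> {1..n}" "u \<in> {1..n}" "u \<noteq> v" for v u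
  proof -
    have "{u, v} \<in> (\<Union>i\<in>{1..r}. C i)"
      using C that by (auto simp: edge_colouring_def complete_graph_def)
    then have "\<exists>i. i \<in> {1..r} \<and> {u, v} \<in> C i" by auto
    from someI_ex[OF this] show "c v u \<in> {1..r}" "{u, v} \<in> C (c v u)" by (auto simp: c_def)
  qed
  have c_eq: "c v u = i \<longleftrightarrow> {u, v} \<in> C i" if "v \<in> {1..n}" "u \<in> {1..n}" "u \<noteq> v" "i \<in> {1..r}" for v u i
    using c[OF that(1-3)] that(4) C by (fastforce simp: edge_colouring_def disjoint_family_on_def)
  have "\<not> even_pair c S T"
    if S: "S \<subseteq> {1..n}" and T: "T \<subseteq> {1..n} - S" and cards: "card S = s" "card T = t" for S T
  proof -
    let ?E = "{{u, v} |u v. u \<in> S \<and> v \<in> T}"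
    have fin: "finite S" "finite T" using S T by (auto intro: finite_subset)
    obtain i where i: "i \<in> {1..r}" "odd (card (?E \<inter> C i))"
      using odd[OF bipartite_is_copy[OF S T cards]] by (auto simp: has_odd_class_def)
    have col: "c v u = i \<longleftrightarrow> {u, v} \<in> C i" if "v \<in> T" "u \<in> S" for u v
      using that S T i(1) by (intro c_eq) auto
    \<comment> \<open>Each edge is listed by its end in \<open>T\<close>; since \<open>S\<close> and
      \<open>T\<close> are disjoint, it is listed only once.\<close>
    have "?E \<inter> C i = (\<lambda>(v, u). {u, v}) ` (SIGMA v:T. {u\<in>S. c v u = i})" (is "_ = ?R")
    proof (intro equalityI subsetI)
      fix e assume "e \<in> ?E \<inter> C i"
      then obtain u v where "u \<in> S" "v \<in> T" "e = {u, v}" "{u, v} \<in> C i" by auto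
      then show "e \<in> ?R" by (intro image_eqI[of _ _ "(v, u)"]) (auto simp: col)
    next
      fix e assume "e \<in> ?R"
      then obtain u v where "u \<in> S" "v \<in> T" "e = {u, v}" "c v u = i" by auto
      then show "e \<in> ?E \<inter> C i" using col by auto
    qed
    moreover have "inj_on (\<lambda>(v, u). {u, v}) (SIGMA v:T. {u\<in>S. c v u = i})"
      using T by (auto simp: inj_on_def doubleton_eq_iff)
    ultimately have "card (?E \<inter> C i) = (\<Sum>v\<in>T. card {u\<in>S. c v u = i})"
      using fin by (simp add: card_image card_SigmaI)
    with i show ?thesis unfolding even_pair_def by metis
  qed
  moreover have "\<forall>v\<in>{1..n}. c v ` ({1..n} - {v}) \<subseteq> {1..r}" using c(1) by blast
  ultimately show ?thesis using that by blast
qed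

text \<open>\<open>LEAST\<close> is meaningful once some colouring qualifies. The rainbow colouring
  does: a copy has an edge, and the class of that edge meets the copy in exactly one edge.\<close>

lemma r_odd_attained:
  assumes "1 \<le> s" "1 \<le> t" "2 \<le> n"
  defines "H \<equiv> complete_bipartite s t"
  obtains C where "r_odd n H > 0" "edge_colouring (complete_graph n) (r_odd n H) C"
    "\<And>F. is_copy H (complete_graph n) F \<Longrightarrow> has_odd_class (r_odd n H) C F"
proof -
  let ?G = "complete_graph n"
  let ?P = "\<lambda>r. r > 0 \<and> (\<exists>C. edge_colouring ?G r C \<and> (\<forall>F. is_copy H ?G F \<longrightarrow> has_odd_class r C F))"
  define m where "m = card (edges ?G)"
  have "finite (edges ?G)" by (simp add: complete_graph_def)
  then obtain f where f: "bij_betw f {1..m} (edges ?G)"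
    using finite_same_card_bij[of "{1..m}" "edges ?G"] by (auto simp: m_def)
  have "{1, 2} \<in> edges ?G" using assms(3) by (auto simp: complete_graph_def)
  then have "m > 0" using \<open>finite (edges ?G)\<close> by (auto simp: m_def card_gt_0_iff)
  moreover have "edge_colouring ?G m (\<lambda>i. {f i})"
    unfolding edge_colouring_def
  proof
    show "disjoint_family_on (\<lambda>i. {f i}) {1..m}"
      using bij_betw_imp_inj_on[OF f] by (simp add: disjoint_family_on_def inj_on_eq_iff)
    show "(\<Union>i\<in>{1..m}. {f i}) = edges ?G"
      using bij_betw_imp_surj_on[OF f] by (simp only: UNION_singleton_eq_range)
  qed
  moreover have "has_odd_class m (\<lambda>i. {f i}) F" if F: "is_copy H ?G F" for F
  proof -
    obtain h where h: "bij_betw h (verts H) (verts F)"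
      "\<And>u v. u \<in> verts H \<Longrightarrow> v \<in> verts H \<Longrightarrow> {u, v} \<in> edges H \<longleftrightarrow> {h u, h v} \<in> edges F"
      using F unfolding is_copy_def isomorphic_def by blast
    have "{Inl 1, Inr 1} \<in> edges H" "Inl 1 \<in> verts H" "Inr 1 \<in> verts H"
      using assms(1,2) by (auto simp: H_def complete_bipartite_def)
    then have e: "{h (Inl 1), h (Inr 1)} \<in> edges F" using h(2) by blast
    moreover have "edges F \<subseteq> edges ?G" using F by (auto simp: is_copy_def subgraph_def)
    ultimately obtain i where "i \<in> {1..m}" "f i = {h (Inl 1), h (Inr 1)}"
      using f unfolding bij_betw_def by (metis imageE subsetD)
    with e show ?thesis unfolding has_odd_class_def by (intro bexI[of _ i]) auto
  qed
  ultimately have "?P m" by blast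
  from LeastI[of ?P, OF this] show ?thesis
    using that unfolding r_odd_def by blast
qed

section \<open>Analytic estimates\<close>

lemma root_bound:
  fixes n t r y :: real
  assumes "K > 0" "n \<ge> 0" "t > 0" "r \<ge> 0" "y \<ge> 0" "n * y ^ K \<le> t * r ^ K"
  shows "y * (n / t) powr (1 / real K) \<le> r"
proof -
  define q where "q = (n / t) powr (1 / real K)"
  have "q ^ K = n / t"
  proof (cases "n = 0")
    case False
    then have pos: "n / t > 0" using assms by simp
    then have "q ^ K = q powr real K" by (intro powr_realpow[symmetric]) (use pos in \<open>auto simp: q_def\<close>)
    also have "\<dots> = n / t" using assms(1) pos by (simp add: q_def powr_powr del: abs_divide)
    finally show ?thesis .
  qed (use assms in \<open>simp add: q_def\<close>)
  then have "(y * q) ^ K = n * y ^ K / t" by (simp add: power_mult_distrib)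
  also have "\<dots> \<le> r ^ K" using assms by (simp add: pos_divide_le_eq mult.commute)
  finally show ?thesis unfolding q_def[symmetric]
    using assms(1,4) power_less_imp_less_base power_strict_mono[of r "y * q" K] by fastforce
qed

text \<open>Applied with \<open>p\<close> equal to \<open>1 / K\<close>: the numerator is sublinear
  exactly because \<open>K\<close> is at least 2.\<close>

lemma slack_tendsto_0:
  fixes p t k :: real
  assumes "0 < p" "p < 1" "t > 0"
  shows "(\<lambda>n. - (((real n / t) powr p + 1) / (real n - k))) \<longlonglongrightarrow> 0"
  using assms by real_asymp


section \<open>Lower bounds for the odd-Ramsey number\<close>

lemma r_odd_even_power_bound:
  fixes n k t :: nat
  defines "r \<equiv> real (r_odd n (complete_bipartite (2 * k) t))"
  assumes "1 \<le> k" "1 \<le> t" "2 * k \<le> n"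
    and x: "0 \<le> x" "x * (real n - 2 * real k + 2) \<le> real n - 2 * real k + 1 - r"
  shows "real n * x ^ k \<le> (real t - 1) * r ^ k"
proof -
  let ?r = "r_odd n (complete_bipartite (2 * k) t)"
  obtain C where "edge_colouring (complete_graph n) ?r C"
    "\<And>F. is_copy (complete_bipartite (2 * k) t) (complete_graph n) F \<Longrightarrow> has_odd_class ?r C F"
    using r_odd_attained[of "2 * k" t n] assms by auto
  then obtain c where c: "\<forall>v\<in>{1..n}. c v ` ({1..n} - {v}) \<subseteq> {1..?r}"
    "\<And>S T. S \<subseteq> {1..n} \<Longrightarrow> T \<subseteq> {1..n} - S \<Longrightarrow> card S = 2 * k \<Longrightarrow> card T = t \<Longrightarrow> \<not> even_pair c S T"
    using no_even_pair_in_odd_colouring by blast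
  show ?thesis
    using many_colours_if_no_even_pair[of "{1..n}" "{1..?r}" c x k t] c x assms(4)
    by (simp add: r_def)
qed

lemma r_odd_odd_power_bound:
  fixes n k t :: nat
  defines "r \<equiv> real (r_odd n (complete_bipartite (2 * k + 1) t))"
  assumes "1 \<le> t" "even t" "2 \<le> n" "2 * k < n"
    and x: "0 \<le> x" "x * (real n - 2 * real k + 2) \<le> real n - 2 * real k + 1 - r"
  shows "real n * x ^ k \<le> real t * r ^ (k + 1)"
proof -
  let ?r = "r_odd n (complete_bipartite (2 * k + 1) t)"
  obtain C where "?r > 0" and "edge_colouring (complete_graph n) ?r C"
    "\<And>F. is_copy (complete_bipartite (2 * k + 1) t) (complete_graph n) F \<Longrightarrow> has_odd_class ?r C F"
    using r_odd_attained[of "2 * k + 1" t n] assms by auto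
  then obtain c where c: "\<forall>v\<in>{1..n}. c v ` ({1..n} - {v}) \<subseteq> {1..?r}"
    "\<And>S T. S \<subseteq> {1..n} \<Longrightarrow> T \<subseteq> {1..n} - S \<Longrightarrow> card S = 2 * k + 1 \<Longrightarrow> card T = t \<Longrightarrow> \<not> even_pair c S T"
    using no_even_pair_in_odd_colouring by blast
  show ?thesis
    using many_colours_if_no_even_pair_odd[of "{1..n}" "{1..?r}" c x k t] c x assms \<open>?r > 0\<close>
    by (simp add: r_def)
qed

text \<open>The case \<open>K = 1\<close> is separate: there \<open>r\<close> may be of order \<open>n\<close>, so the relative error
  \<open>(r + 1) / n\<close> of a single averaging step need not vanish. It is absorbed by using that
  fewer than \<open>t\<close> means at most \<open>t - 1\<close>.\<close>

lemma r_odd_linear_bound: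
  assumes "1 \<le> s" "s \<le> 2" "s \<le> t" "even (s * t)" "2 \<le> n"
  shows "real n - 1 \<le> real t * real (r_odd n (complete_bipartite s t))"
proof -
  define r where "r = real (r_odd n (complete_bipartite s t))"
  have "real n - 1 \<le> real t * r"
  proof (cases "r \<le> real n - 1")
    case False
    moreover have "1 * r \<le> real t * r" using assms by (intro mult_right_mono) (auto simp: r_def)
    ultimately show ?thesis by linarith
  next
    case True
    consider "s = 1" | "s = 2" using assms by linarith
    then show ?thesis
    proof cases
      case 1
      \<comment> \<open>With \<open>k = 0\<close> the conclusion involves only
        \<open>x ^ 0 = 1\<close>, so \<open>x = 0\<close> is the cheapest choice.\<close>
      then show ?thesis
        using r_odd_odd_power_bound[of t n 0 0] assms True by (simp add: r_def)
    next
      case 2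
      \<comment> \<open>This choice gives equality in the condition on \<open>x\<close> for
        \<open>k = 1\<close>. The result reads \<open>n - 1 - r \<le> (t - 1) * r\<close>, and the
        lost \<open>r\<close> is absorbed on the right.\<close>
      define x where "x = 1 - (r + 1) / real n"
      have nx: "x * real n = real n - 1 - r" using assms by (simp add: x_def field_simps)
      have "0 \<le> x" using True assms by (simp add: x_def field_simps)
      then have "real n * x \<le> (real t - 1) * r"
        using r_odd_even_power_bound[of 1 t n x] assms 2 nx by (simp add: r_def del: One_nat_def)
      with nx show ?thesis by (simp add: algebra_simps)
    qed
  qed
  then show ?thesis by (simp add: r_def)
qed

text \<open>One form for both parities of \<open>s\<close>: the even case relaxes
  \<open>t - 1\<close> to \<open>t\<close>, the odd case gives up a factor \<open>y\<close>, which
  is at most 1.\<close>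

lemma r_odd_power_bound:
  fixes s t n :: nat
  defines "K \<equiv> (s + 1) div 2" and "r \<equiv> real (r_odd n (complete_bipartite s t))"
  assumes "1 \<le> s" "s \<le> t" "even (s * t)" "2 \<le> n" "s < n"
    and y: "0 \<le> y" "y \<le> 1" "y * (real n - 2 * real K + 2) \<le> real n - 2 * real K + 1 - r"
  shows "real n * y ^ K \<le> real t * r ^ K"
proof (cases "even s")
  case True
  then obtain k where k: "s = 2 * k" by blast
  then have "K = k" by (simp add: K_def)
  have "real n * y ^ k \<le> (real t - 1) * r ^ k"
    unfolding r_def k using assms k \<open>K = k\<close> by (intro r_odd_even_power_bound) auto
  also have "\<dots> \<le> real t * r ^ k" by (intro mult_right_mono) (auto simp: r_def)
  finally show ?thesis using \<open>K = k\<close> by simp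
next
  case False
  then obtain k where k: "s = 2 * k + 1" by (blast elim: oddE)
  then have K: "K = k + 1" by (simp add: K_def)
  have "real n * y ^ K \<le> real n * y ^ k"
    using y by (simp add: K mult_left_mono mult_left_le_one_le)
  also have "\<dots> \<le> real t * r ^ (k + 1)"
    unfolding r_def k
  proof (rule r_odd_odd_power_bound)
    \<comment> \<open>Replacing \<open>K\<close> by \<open>k = K - 1\<close> adds
      \<open>2 * y\<close> on the left and 2 on the right.\<close>
    show "y * (real n - 2 * real k + 2) \<le> real n - 2 * real k + 1 - real (r_odd n (complete_bipartite (2 * k + 1) t))"
      using y unfolding r_def k K[unfolded k] by (simp add: K algebra_simps)
  qed (use assms k in auto)
  finally show ?thesis by (simp add: K)
qed

theorem theorem1p5:
  fixes s t :: nat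
  assumes "1 \<le> s" and "s \<le> t" and "even (s * t)"
  shows "\<exists>\<epsilon> :: nat \<Rightarrow> real. \<epsilon> \<longlonglongrightarrow> 0 \<and>
    (\<forall>\<^sub>F n in sequentially.
       real (r_odd n (complete_bipartite s t))
         \<ge> (1 + \<epsilon> n) * (real n / real t) powr (1 / of_int \<lceil>real s / 2\<rceil>))"
proof -
  define K where "K = (s + 1) div 2"
  define r where "r n = real (r_odd n (complete_bipartite s t))" for n
  define q where "q n = (real n / real t) powr (1 / real K)" for n
  have K: "of_int \<lceil>real s / 2\<rceil> = real K"
  proof -
    have "\<lceil>real s / 2\<rceil> = int K"
      unfolding K_def by (rule ceiling_unique) (cases "even s"; auto elim!: evenE oddE)+
    then show ?thesis by simp
  qed
  have "\<exists>\<epsilon>. \<epsilon> \<longlonglongrightarrow> 0 \<and> (\<forall>\<^sub>F n in sequentially. (1 + \<epsilon> n) * q n \<le> r n)"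
  proof (cases "K = 1")
    case True
    have "(1 + - (1 / real n)) * q n \<le> r n" if "n \<ge> 2" for n
    proof -
      have "s \<le> 2" using True by (simp add: K_def)
      then have "real n - 1 \<le> real t * r n"
        using r_odd_linear_bound[of s t n] assms that by (simp add: r_def)
      moreover have "(1 + - (1 / real n)) * q n = (real n - 1) / real t"
        using that True by (simp add: q_def left_diff_distrib diff_divide_distrib)
      ultimately show ?thesis using assms by (simp add: pos_divide_le_eq mult.commute)
    qed
    then have "\<forall>\<^sub>F n in sequentially. (1 + - (1 / real n)) * q n \<le> r n"
      by (rule eventually_sequentiallyI)
    moreover have "(\<lambda>n. - (1 / real n)) \<longlonglongrightarrow> 0" by real_asymp
    ultimately show ?thesis by (intro exI[of _ "\<lambda>n. - (1 / real n)"]) auto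
  next
    case False
    then have K2: "K \<ge> 2" using assms by (auto simp: K_def)
    \<comment> \<open>Chosen so that \<open>y = 1 + \<epsilon> n\<close> gives equality in the
      condition of \<open>r_odd_power_bound\<close> with \<open>q n\<close> in place of
      \<open>r n\<close>.\<close>
    define \<epsilon> where "\<epsilon> n = - ((q n + 1) / (real n - (2 * real K - 2)))" for n
    have "(1 + \<epsilon> n) * q n \<le> r n" if n: "n \<ge> 2 * s + 2" for n
    proof -
      define d where "d = real n - (2 * real K - 2)"
      have d: "d > 0" using n by (auto simp: d_def K_def)
      have eps: "\<epsilon> n = - ((q n + 1) / d)" by (simp add: \<epsilon>_def d_def)
      have q0: "q n \<ge> 0" by (simp add: q_def)
      have "\<epsilon> n \<le> 0" using d q0 by (simp add: eps)
      \<comment> \<open>For \<open>r n < q n\<close> the error term, which involves \<open>r n\<close>, is bounded by one in \<open>q n\<close>.\<close>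
      consider "q n \<le> r n" | "1 + \<epsilon> n \<le> 0" | "r n < q n" "1 + \<epsilon> n > 0" by linarith
      then show ?thesis
      proof cases
        case 1
        have "(1 + \<epsilon> n) * q n \<le> 1 * q n" using \<open>\<epsilon> n \<le> 0\<close> q0 by (intro mult_right_mono) auto
        with 1 show ?thesis by simp
      next
        case 2
        then have "(1 + \<epsilon> n) * q n \<le> 0" using q0 by (rule mult_nonpos_nonneg)
        also have "0 \<le> r n" by (simp add: r_def)
        finally show ?thesis .
      next
        case 3
        have "(1 + \<epsilon> n) * d = d - (q n + 1)" using d by (simp add: eps field_simps)
        then have "(1 + \<epsilon> n) * (real n - 2 * real K + 2) \<le> real n - 2 * real K + 1 - r n"
          using 3 by (simp add: d_def algebra_simps)
        then have "real n * (1 + \<epsilon> n) ^ K \<le> real t * r n ^ K"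
          unfolding K_def r_def using assms n 3 \<open>\<epsilon> n \<le> 0\<close>
          by (intro r_odd_power_bound) auto
        then show ?thesis
          unfolding q_def using assms K2 3 by (intro root_bound) (auto simp: r_def)
      qed
    qed
    then have "\<forall>\<^sub>F n in sequentially. (1 + \<epsilon> n) * q n \<le> r n"
      by (rule eventually_sequentiallyI)
    moreover have "\<epsilon> \<longlonglongrightarrow> 0"
      unfolding \<epsilon>_def q_def using assms K2 by (intro slack_tendsto_0) auto
    ultimately show ?thesis by blast
  qed
  then show ?thesis unfolding K q_def r_def .
qed

end
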